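(* Let $n\ge 1$ and let $\mu$ and $\nu$ be probability measures on $\Omega=\{-1,+1\}^n$ with Glauber dynamics kernels $P$ and $Q$, respectively. Assume that $P$ is irreducible. Let $f:\Omega\to\mathbb{R}$ be any function and let $h:\Omega\to\mathbb{R}$ be a solution to the Poisson equation $h-Ph=f-\mathbb{E}_\mu f$. Then $$|\mathbb{E}_\mu f-\mathbb{E}_\nu f|\le \mathbb{E}_\nu\Big(\frac1n\sum_{i=1}^n|\Delta_i(h)|\cdot\|\mu_i(\cdot|x^{(\sim i)})-\nu_i(\cdot|x^{(\sim i)})\|_{\mathsf{TV}}\Big).$$ Furthermore, if $P$ is $\alpha$-contractive (with $\alpha\in[0,1)$) and $f$ is $L$-Lipschitz with respect to the Hamming metric, then $$|\mathbb{E}_\mu f-\mathbb{E}_\nu f|\le \frac{L}{1-\alpha}\,\mathbb{E}_\nu\Big(\frac1n\sum_{i=1}^n\|\mu_i(\cdot|x^{(\sim i)})-\nu_i(\cdot|x^{(\sim i)})\|_{\mathsf{TV}}\Big),$$ and, if $Z_\mu\sim\mu$ and $Z_\nu\sim\nu$, then also $$d_W\big(f(Z_\mu),f(Z_\nu)\big)\le \frac{L}{1-\alpha}\,\mathbb{E}_\nu\Big(\frac1n\sum_{i=1}^n\|\mu_i(\cdot|x^{(\sim i)})-\nu_i(\cdot|x^{(\sim i)})\|_{\mathsf{TV}}\Big).$$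
   Context: Notation. For $x\in\Omega=\{-1,+1\}^n$, $x^{(\sim i)}$ denotes the values of $x$ at all coordinates except the $i$th; $x^{(i,+)}$ and $x^{(i,-)}$ denote the vectors obtained from $x$ by setting the $i$th coordinate to $+1$ and $-1$ respectively. For $h:\Omega\to\mathbb{R}$, the discrete derivative is the function $\Delta_i(h)(x)=h(x^{(i,+)})-h(x^{(i,-)})$. For a probability measure $p$ on $\Omega$ with $p(x^{(\sim i)})>0$, $p_i(\cdot|x^{(\sim i)})$ is the conditional distribution of the $i$th coordinate given that the other coordinates equal $x^{(\sim i)}$. In expectations $\mathbb{E}_\nu(\cdot)$, $x$ is distributed according to $\nu$. $\|\cdot\|_{\mathsf{TV}}$ is total variation distance. Glauber dynamics generated by $p$: from state $X$, pick $I\in[n]=\{1,\dots,n\}$ uniformly at random, keep all coordinates other than $I$ unchanged, and resample coordinate $I$ from $p_I(\cdot|X^{(\sim I)})$. For a kernel $P$, $(Ph)(x)=\sum_y P(x,y)h(y)$. Hamming distance: $d_H(x,y)=\sum_{i=1}^n\mathbf 1_{x^i\neq y^i}$. $f$ is $L$-Lipschitz if $|f(x)-f(y)|\le L\,d_H(x,y)$ for all $x,y\in\Omega$. For $\alpha\in[0,1)$, the kernel $P$ is $\alpha$-contractive if there is a coupling of two chains $(X_t),(Y_t)$, both evolving according to $P$, such that $\mathbb{E}[d_H(X_t,Y_t)\mid X_0=x,Y_0=y]\le\alpha^t d_H(x,y)$ for all $x,y\in\Omega$ and all $t\in\mathbb{N}$. For real random variables $W_1,W_2$, the 1-Wasserstein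 distance is $d_W(W_1,W_2)=\sup_g\big(\mathbb{E}g(W_1)-\mathbb{E}g(W_2)\big)$, the supremum being over 1-Lipschitz functions $g:\mathbb{R}\to\mathbb{R}$. *)

theory Defs
  imports "HOL-Probability.Probability"
begin

text \<open>
  The configuration space \<open>{-1,+1}\<^sup>n\<close> is the function type \<open>'n \<Rightarrow> spin\<close> over a finite index
  type, with \<open>n = CARD('n) \<ge> 1\<close>. Probability measures on it are \<open>pmf\<close>s.
\<close>

datatype spin = Minus | Plus

lemma UNIV_spin: "UNIV = {Minus, Plus}"
  using spin.exhaust by auto

instance spin :: finite
  by standard (simp add: UNIV_spin)

type_synonym 'n config = "'n \<Rightarrow> spin"

definition discrete_deriv :: "'n \<Rightarrow> ('n config \<Rightarrow> real) \<Rightarrow> 'n config \<Rightarrow> real" where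
  "discrete_deriv i h x = h (x(i := Plus)) - h (x(i := Minus))"

text \<open>
  The conditional law of coordinate \<open>i\<close> given the other coordinates of \<open>x\<close>. If the conditioning
  event has probability zero, \<^const>\<open>cond_pmf\<close> is an unspecified probability measure. This choice
  plays no role: the support of \<open>p\<close> is nonempty and closed under the dynamics below, so irreducibility
  forces full support, and expectations under \<open>p\<close> only see configurations of positive probability.
\<close>

definition cond_coord :: "'n config pmf \<Rightarrow> 'n \<Rightarrow> 'n config \<Rightarrow> spin pmf" where
  "cond_coord p i x = map_pmf (\<lambda>y. y i) (cond_pmf p {y. \<forall>j. j \<noteq> i \<longrightarrow> y j = x j})"

definition glauber :: "('n::finite) config pmf \<Rightarrow> 'n config \<Rightarrow> 'n config pmf" where
  "glauber p x =
    bind_pmf (pmf_of_set UNIV) (\<lambda>i. map_pmf (\<lambda>s. x(i := s)) (cond_coord p i x))"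

definition kernel_app :: "('a::finite \<Rightarrow> 'a pmf) \<Rightarrow> ('a \<Rightarrow> real) \<Rightarrow> 'a \<Rightarrow> real" where
  "kernel_app P h x = (\<Sum>y\<in>UNIV. pmf (P x) y * h y)"

primrec kernel_power :: "('a \<Rightarrow> 'a pmf) \<Rightarrow> nat \<Rightarrow> 'a \<Rightarrow> 'a pmf" where
  "kernel_power P 0 x = return_pmf x"
| "kernel_power P (Suc t) x = bind_pmf (P x) (kernel_power P t)"

definition irreducible_kernel :: "('a \<Rightarrow> 'a pmf) \<Rightarrow> bool" where
  "irreducible_kernel P \<longleftrightarrow> (\<forall>x y. \<exists>t. pmf (kernel_power P t x) y > 0)"

definition tv_dist :: "'a pmf \<Rightarrow> 'a pmf \<Rightarrow> real" where
  "tv_dist p q = (SUP A. \<bar>measure_pmf.prob p A - measure_pmf.prob q A\<bar>)"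

definition hamming :: "('n::finite) config \<Rightarrow> 'n config \<Rightarrow> real" where
  "hamming x y = (\<Sum>i\<in>UNIV. if x i \<noteq> y i then 1 else 0)"

definition hamming_lipschitz :: "real \<Rightarrow> (('n::finite) config \<Rightarrow> real) \<Rightarrow> bool" where
  "hamming_lipschitz L f \<longleftrightarrow> (\<forall>x y. \<bar>f x - f y\<bar> \<le> L * hamming x y)"

text \<open>
  \<open>X\<close> is a Markov chain on the probability space \<open>M\<close> with kernel \<open>P\<close> and deterministic initial
  state \<open>x\<close>; the law of the chain is given by its finite-dimensional distributions.
\<close>

definition markov_chain_from ::
    "('a \<Rightarrow> 'a pmf) \<Rightarrow> 'a \<Rightarrow> 'w measure \<Rightarrow> (nat \<Rightarrow> 'w \<Rightarrow> 'a) \<Rightarrow> bool" where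
  "markov_chain_from P x M X \<longleftrightarrow>
    prob_space M \<and>
    (\<forall>t. X t \<in> measurable M (count_space UNIV)) \<and>
    (\<forall>t z. measure M {w \<in> space M. \<forall>s\<le>t. X s w = z s} =
      (if z 0 = x then \<Prod>s<t. pmf (P (z s)) (z (Suc s)) else 0))"

text \<open>
  The conditioning on \<open>X\<^sub>0 = x, Y\<^sub>0 = y\<close> means that the coupled pair of chains is started at
  \<open>(x, y)\<close>. The coupling need not be Markovian. Taking the sample space of type
  \<open>nat \<Rightarrow> 'n config \<times> 'n config\<close> is no restriction, since any coupling can be
  transported to the path space of the pair.
\<close>

definition contractive :: "real \<Rightarrow> (('n::finite) config \<Rightarrow> 'n config pmf) \<Rightarrow> bool" where
  "contractive \<alpha> P \<longleftrightarrow>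
    (\<forall>x y. \<exists>(M :: (nat \<Rightarrow> 'n config \<times> 'n config) measure) X Y.
      markov_chain_from P x M X \<and> markov_chain_from P y M Y \<and>
      (\<forall>t. (\<integral>w. hamming (X t w) (Y t w) \<partial>M) \<le> \<alpha> ^ t * hamming x y))"

text \<open>
  The 1-Wasserstein distance between the real random variables \<open>V\<close> on \<open>M\<close> and \<open>W\<close> on \<open>N\<close>,
  intended for integrable \<open>V\<close> and \<open>W\<close>.
\<close>

definition wasserstein :: "'a measure \<Rightarrow> ('a \<Rightarrow> real) \<Rightarrow> 'b measure \<Rightarrow> ('b \<Rightarrow> real) \<Rightarrow> ereal" where
  "wasserstein M V N W =
    (SUP g \<in> {g :: real \<Rightarrow> real. 1-lipschitz_on UNIV g}.
      ereal ((\<integral>w. g (V w) \<partial>M) - (\<integral>w. g (W w) \<partial>N)))"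

definition has_law :: "'w measure \<Rightarrow> ('w \<Rightarrow> 'a) \<Rightarrow> 'a pmf \<Rightarrow> bool" where
  "has_law M Z p \<longleftrightarrow>
    prob_space M \<and> Z \<in> measurable M (count_space UNIV) \<and>
    distr M (count_space UNIV) Z = measure_pmf p"

end

theory Submission
  imports Defs
begin

text \<open>
  Stein's method for the Glauber kernel \<open>P\<close> of \<open>\<mu>\<close>. If \<open>h\<close> solves the Poisson equation of \<open>P\<close>, then
  stationarity of \<open>\<nu>\<close> under its own kernel \<open>Q\<close> gives
  \<open>\<nu> f - \<mu> f = \<nu> (h - P h) = \<nu> (Q h - P h)\<close>, and \<open>Q h - P h\<close> is an average over the coordinates of
  \<open>\<Delta>\<^sub>i h\<close> times the difference of the conditional probabilities of \<open>+1\<close>. Under contraction,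
  \<open>h = \<Sum>\<^sub>t (P\<^sup>t f - \<mu> f)\<close> solves the equation, and the contraction applied to two configurations
  that differ in one coordinate bounds its discrete derivatives by \<open>L / (1 - \<alpha>)\<close>. For the
  Wasserstein distance, \<open>g \<circ> f\<close> is \<open>L\<close>-Lipschitz whenever \<open>g\<close> is 1-Lipschitz.
\<close>

section \<open>Expectations over finite types and total variation\<close>

lemma integrable_pmf_finite_type:
  "integrable (measure_pmf p) (f :: 'a::finite \<Rightarrow> real)"
  by (rule integrable_measure_pmf_finite) simp

lemma expectation_pmf_finite_type:
  "measure_pmf.expectation p (f :: 'a::finite \<Rightarrow> real) = (\<Sum>y\<in>UNIV. pmf p y * f y)"
  by (subst integral_measure_pmf_real[where A = UNIV]) (auto simp: mult.commute)

lemma expectation_bind_finite_type: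
  fixes f :: "'b::finite \<Rightarrow> real" and K :: "'a::finite \<Rightarrow> 'b pmf"
  shows "measure_pmf.expectation (bind_pmf p K) f =
    measure_pmf.expectation p (\<lambda>x. measure_pmf.expectation (K x) f)"
  by (subst pmf_expectation_bind[where A = UNIV]) (auto simp: expectation_pmf_finite_type)

lemma kernel_app_eq_expectation: "kernel_app P h x = measure_pmf.expectation (P x) h"
  by (simp add: kernel_app_def expectation_pmf_finite_type)

lemma abs_prob_diff_le_tv_dist:
  "\<bar>measure_pmf.prob p A - measure_pmf.prob q A\<bar> \<le> tv_dist p q"
  unfolding tv_dist_def
proof (rule cSUP_upper)
  \<comment> \<open>A supremum of reals bounds its members only when the family is bounded above;
    two numbers in [0, 1] differ by at most 1.\<close>
  have "\<bar>measure_pmf.prob p B - measure_pmf.prob q B\<bar> \<le> 1" for B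
    using measure_pmf.prob_le_1[of p B] measure_pmf.prob_le_1[of q B]
      measure_nonneg[of p B] measure_nonneg[of q B] by linarith
  then show "bdd_above (range (\<lambda>B. \<bar>measure_pmf.prob p B - measure_pmf.prob q B\<bar>))"
    by (intro bdd_aboveI2)
qed simp

lemma tv_dist_nonneg: "0 \<le> tv_dist p q"
  using abs_prob_diff_le_tv_dist[of p "{}" q] by simp

section \<open>Stationarity and one-step comparison of Glauber dynamics\<close>

text \<open>Every \<open>y\<close> in the conditioned support agrees with \<open>x\<close> off
  \<open>i\<close>, so writing \<open>y i\<close> into \<open>x\<close> gives back \<open>y\<close>.
  Since \<open>x\<close> lies in the support of \<open>p\<close>, the conditioning event has
  positive probability and \<open>cond_pmf\<close> is specified.\<close>

lemma resample_coord_eq_cond_pmf: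
  assumes "x \<in> set_pmf p"
  shows "map_pmf (\<lambda>s. x(i := s)) (cond_coord p i x) =
    cond_pmf p {y. \<forall>j. j \<noteq> i \<longrightarrow> y j = x j}"
proof -
  let ?S = "{y. \<forall>j. j \<noteq> i \<longrightarrow> y j = x j}"
  have ne: "set_pmf p \<inter> ?S \<noteq> {}"
    using assms by blast
  have "x(i := y i) = y" if "y \<in> set_pmf (cond_pmf p ?S)" for y
    using that by (auto simp: set_cond_pmf[OF ne] fun_eq_iff)
  then have "map_pmf (\<lambda>y. x(i := y i)) (cond_pmf p ?S) = map_pmf (\<lambda>y. y) (cond_pmf p ?S)"
    by (intro map_pmf_cong) auto
  then show ?thesis
    by (simp add: cond_coord_def pmf.map_comp o_def)
qed

text \<open>Agreement off \<open>i\<close> is an equivalence relation \<open>R\<close>. Resampling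
  the coordinate redraws the configuration from \<open>p\<close> conditioned on its class, which
  preserves \<open>p\<close>: the weight of a class cancels against the normalisation of the
  conditional law.\<close>

lemma bind_resample_coord:
  "bind_pmf p (\<lambda>x. map_pmf (\<lambda>s. x(i := s)) (cond_coord p i x)) = (p :: ('n::finite) config pmf)"
proof -
  define R where "R x y \<longleftrightarrow> (\<forall>j. j \<noteq> i \<longrightarrow> y j = x j)" for x y :: "'n config"
  have "bind_pmf p (\<lambda>x. map_pmf (\<lambda>s. x(i := s)) (cond_coord p i x)) =
      bind_pmf p (\<lambda>x. cond_pmf p {y. R x y})"
    unfolding R_def by (intro bind_pmf_cong refl resample_coord_eq_cond_pmf)
  also have "\<dots> = p"
  proof (rule bind_cond_pmf_cancel)
    fix x assume x: "x \<in> set_pmf p"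
    show "set_pmf p \<inter> {y. R x y} \<noteq> {}" and "set_pmf p \<inter> {y. R y x} \<noteq> {}"
      using x by (auto simp: R_def)
    fix y assume "y \<in> set_pmf p" and "R x y"
    then have "{z. R x z} = {z. R z y}"
      by (auto simp: R_def)
    then show "measure_pmf.prob p {z. R x z} = measure_pmf.prob p {z. R z y}"
      by simp
  qed
  finally show ?thesis .
qed

text \<open>Glauber dynamics mixes the single-coordinate resamplings, each of which preserves
  \<open>p\<close>. The choice of \<open>i\<close> is independent of the state, so the two draws
  commute.\<close>

lemma bind_glauber: "bind_pmf p (glauber p) = p"
proof -
  have "bind_pmf p (glauber p) = bind_pmf (pmf_of_set UNIV)
      (\<lambda>i. bind_pmf p (\<lambda>x. map_pmf (\<lambda>s. x(i := s)) (cond_coord p i x)))"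
    unfolding glauber_def by (rule bind_commute_pmf)
  then show ?thesis
    by (simp add: bind_resample_coord)
qed

text \<open>A law on two spins is determined by its mass at \<open>Plus\<close>. In this form the
  measure \<open>p\<close> enters only as a coefficient of the discrete derivative, and the
  \<open>Minus\<close> terms cancel when two kernels are compared at the same
  \<open>x\<close>.\<close>

lemma expectation_glauber:
  fixes h :: "('n::finite) config \<Rightarrow> real"
  shows "measure_pmf.expectation (glauber p x) h = 1 / real CARD('n) *
    (\<Sum>i\<in>UNIV. h (x(i := Minus)) + pmf (cond_coord p i x) Plus * discrete_deriv i h x)"
proof -
  have "measure_pmf.expectation (cond_coord p i x) (\<lambda>s. h (x(i := s))) =
      h (x(i := Minus)) + pmf (cond_coord p i x) Plus * discrete_deriv i h x" for i
  proof -
    have "(\<Sum>s\<in>UNIV. pmf (cond_coord p i x) s) = 1"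
      by (rule sum_pmf_eq_1) auto
    then have minus: "pmf (cond_coord p i x) Minus = 1 - pmf (cond_coord p i x) Plus"
      by (simp add: UNIV_spin)
    show ?thesis
      by (simp add: expectation_pmf_finite_type UNIV_spin discrete_deriv_def minus algebra_simps)
  qed
  then show ?thesis
    unfolding glauber_def by (simp add: expectation_bind_finite_type integral_pmf_of_set)
qed

lemma abs_glauber_diff_le:
  fixes h :: "('n::finite) config \<Rightarrow> real"
  shows "\<bar>measure_pmf.expectation (glauber p x) h - measure_pmf.expectation (glauber q x) h\<bar> \<le>
    1 / real CARD('n) *
      (\<Sum>i\<in>UNIV. \<bar>discrete_deriv i h x\<bar> * tv_dist (cond_coord p i x) (cond_coord q i x))"
proof -
  have "measure_pmf.expectation (glauber p x) h - measure_pmf.expectation (glauber q x) h =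
    1 / real CARD('n) * (\<Sum>i\<in>UNIV. discrete_deriv i h x *
      (pmf (cond_coord p i x) Plus - pmf (cond_coord q i x) Plus))"
    unfolding expectation_glauber right_diff_distrib[symmetric] sum_subtractf[symmetric]
    by (simp add: algebra_simps)
  moreover have "\<bar>\<Sum>i\<in>UNIV. discrete_deriv i h x *
      (pmf (cond_coord p i x) Plus - pmf (cond_coord q i x) Plus)\<bar> \<le>
      (\<Sum>i\<in>UNIV. \<bar>discrete_deriv i h x\<bar> * tv_dist (cond_coord p i x) (cond_coord q i x))"
    using abs_prob_diff_le_tv_dist[of "cond_coord p _ x" "{Plus}" "cond_coord q _ x"]
    by (intro order_trans[OF sum_abs] sum_mono)
      (auto simp: abs_mult measure_pmf_single intro!: mult_left_mono)
  ultimately show ?thesis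
    by (simp add: abs_mult divide_right_mono)
qed

section \<open>Comparison through the Poisson equation\<close>

lemma poisson_bound:
  fixes \<mu> \<nu> :: "('n::finite) config pmf"
  assumes poisson: "\<And>x. h x - kernel_app (glauber \<mu>) h x = f x - measure_pmf.expectation \<mu> f"
  shows "\<bar>measure_pmf.expectation \<mu> f - measure_pmf.expectation \<nu> f\<bar>
    \<le> measure_pmf.expectation \<nu> (\<lambda>x. 1 / real CARD('n) *
        (\<Sum>i\<in>UNIV. \<bar>discrete_deriv i h x\<bar> * tv_dist (cond_coord \<mu> i x) (cond_coord \<nu> i x)))"
proof -
  let ?P = "\<lambda>x. measure_pmf.expectation (glauber \<mu> x) h"
  let ?Q = "\<lambda>x. measure_pmf.expectation (glauber \<nu> x) h"
  have f: "f = (\<lambda>x. h x - ?P x + measure_pmf.expectation \<mu> f)"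
    using poisson by (auto simp: kernel_app_eq_expectation algebra_simps)
  have "measure_pmf.expectation \<nu> f =
      measure_pmf.expectation \<nu> h - measure_pmf.expectation \<nu> ?P + measure_pmf.expectation \<mu> f"
    by (subst f) (simp add: integrable_pmf_finite_type)
  \<comment> \<open>Stationarity of \<nu> under its own dynamics turns the difference of
    expectations into a comparison of two single steps from the same state.\<close>
  moreover have "measure_pmf.expectation \<nu> h = measure_pmf.expectation \<nu> ?Q"
    by (subst (1) bind_glauber[symmetric]) (rule expectation_bind_finite_type)
  ultimately have "measure_pmf.expectation \<mu> f - measure_pmf.expectation \<nu> f =
      measure_pmf.expectation \<nu> (\<lambda>x. ?P x - ?Q x)"
    by (simp add: integrable_pmf_finite_type)
  also have "\<bar>\<dots>\<bar> \<le> measure_pmf.expectation \<nu> (\<lambda>x. \<bar>?P x - ?Q x\<bar>)"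
    by (rule integral_abs_bound)
  also have "\<dots> \<le> measure_pmf.expectation \<nu> (\<lambda>x. 1 / real CARD('n) *
        (\<Sum>i\<in>UNIV. \<bar>discrete_deriv i h x\<bar> * tv_dist (cond_coord \<mu> i x) (cond_coord \<nu> i x)))"
    by (intro integral_mono integrable_pmf_finite_type abs_glauber_diff_le)
  finally show ?thesis .
qed

section \<open>Marginal laws of Markov chains\<close>

text \<open>Fixing a whole prefix, and not only the state at time \<open>t\<close>, matches the
  finite-dimensional distributions and makes the induction work: \<open>kernel_power\<close> peels
  off the first step, so the prefix grows by one state while \<open>m\<close> drops by one.\<close>

lemma markov_chain_from_prefix:
  fixes P :: "'a::finite \<Rightarrow> 'a pmf"
  assumes "markov_chain_from P x M X"
  shows "measure M {w \<in> space M. (\<forall>s\<le>t. X s w = z s) \<and> X (t + m) w = b} =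
    measure M {w \<in> space M. \<forall>s\<le>t. X s w = z s} * pmf (kernel_power P m (z t)) b"
proof (induction m arbitrary: t z)
  case 0
  have "{w \<in> space M. (\<forall>s\<le>t. X s w = z s) \<and> X (t + 0) w = b} =
      (if z t = b then {w \<in> space M. \<forall>s\<le>t. X s w = z s} else {})"
    by auto
  then show ?case
    by simp
next
  case (Suc m)
  interpret prob_space M
    using assms by (simp add: markov_chain_from_def)
  have X[measurable]: "X s \<in> measurable M (count_space UNIV)" for s
    using assms by (simp add: markov_chain_from_def)
  \<comment> \<open>The path \<open>?z y\<close> extends the prefix by the state \<open>y\<close> at
    time \<open>Suc t\<close>; the event is split over all such \<open>y\<close>.\<close>
  let ?z = "\<lambda>y. z(Suc t := y)"
  let ?S = "\<lambda>y. {w \<in> space M. (\<forall>s\<le>Suc t. X s w = ?z y s) \<and> X (Suc t + m) w = b}"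
  have prefix: "(\<forall>s\<le>Suc t. X s w = ?z y s) \<longleftrightarrow> (\<forall>s\<le>t. X s w = z s) \<and> X (Suc t) w = y" for y w
    by (auto simp: le_Suc_eq)
  have step: "measure M {w \<in> space M. \<forall>s\<le>Suc t. X s w = ?z y s} =
      measure M {w \<in> space M. \<forall>s\<le>t. X s w = z s} * pmf (P (z t)) y" for y
    using assms by (simp add: markov_chain_from_def cong: prod.cong_simp)
  have union: "{w \<in> space M. (\<forall>s\<le>t. X s w = z s) \<and> X (t + Suc m) w = b} = (\<Union>y. ?S y)"
    unfolding prefix by auto
  have "measure M {w \<in> space M. (\<forall>s\<le>t. X s w = z s) \<and> X (t + Suc m) w = b} =
      (\<Sum>y\<in>UNIV. measure M (?S y))"
    unfolding union
    by (rule finite_measure_finite_Union) (auto simp: disjoint_family_on_def)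
  also have "\<dots> = (\<Sum>y\<in>UNIV. measure M {w \<in> space M. \<forall>s\<le>t. X s w = z s} * pmf (P (z t)) y *
      pmf (kernel_power P m y) b)"
  proof (rule sum.cong[OF refl])
    fix y
    show "measure M (?S y) = measure M {w \<in> space M. \<forall>s\<le>t. X s w = z s} * pmf (P (z t)) y *
        pmf (kernel_power P m y) b"
      by (subst Suc.IH, subst step) (simp only: fun_upd_same)
  qed
  also have "\<dots> = measure M {w \<in> space M. \<forall>s\<le>t. X s w = z s} * pmf (kernel_power P (Suc m) (z t)) b"
    by (simp add: pmf_bind expectation_pmf_finite_type sum_distrib_left mult.assoc)
  finally show ?case .
qed

lemma markov_chain_from_marginal:
  fixes P :: "'a::finite \<Rightarrow> 'a pmf"
  assumes "markov_chain_from P x M X"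
  shows "distr M (count_space UNIV) (X t) = measure_pmf (kernel_power P t x)"
proof -
  interpret prob_space M
    using assms by (simp add: markov_chain_from_def)
  have X[measurable]: "X s \<in> measurable M (count_space UNIV)" for s
    using assms by (simp add: markov_chain_from_def)
  \<comment> \<open>The finite-dimensional distribution at time 0 along a constant path has an empty
    product, hence mass 1 or 0.\<close>
  have start: "measure M {w \<in> space M. X 0 w = a} = (if a = x then 1 else 0)" for a
    using assms unfolding markov_chain_from_def
    by (elim conjE allE[of _ 0] allE[of _ "\<lambda>_. a"]) simp
  have "measure M {w \<in> space M. X t w = b} = pmf (kernel_power P t x) b" for b
  proof -
    have "{w \<in> space M. X t w = b} = (\<Union>a. {w \<in> space M. X 0 w = a \<and> X t w = b})"
      by auto
    also have "measure M \<dots> = (\<Sum>a\<in>UNIV. measure M {w \<in> space M. X 0 w = a \<and> X t w = b})"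
      by (rule finite_measure_finite_Union) (auto simp: disjoint_family_on_def)
    also have "\<dots> = (\<Sum>a\<in>UNIV. (if a = x then 1 else 0) * pmf (kernel_power P t a) b)"
      using markov_chain_from_prefix[OF assms, of 0 "\<lambda>_. _" t b] by (simp add: start)
    also have "\<dots> = pmf (kernel_power P t x) b"
      by (simp add: if_distrib[of "\<lambda>u. u * _"] cong: if_cong)
    finally show ?thesis .
  qed
  then show ?thesis
    by (intro measure_eqI_countable[where A = UNIV])
      (auto simp: emeasure_distr emeasure_eq_measure vimage_def Int_def conj_commute
        emeasure_pmf_single)
qed

lemma markov_chain_from_integral:
  fixes P :: "'a::finite \<Rightarrow> 'a pmf" and f :: "'a \<Rightarrow> real"
  assumes "markov_chain_from P x M X"
  shows "(\<integral>w. f (X t w) \<partial>M) = measure_pmf.expectation (kernel_power P t x) f"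
  using assms
  by (subst markov_chain_from_marginal[OF assms, symmetric], subst integral_distr)
    (auto simp: markov_chain_from_def)

section \<open>Contraction and the solution of the Poisson equation\<close>

text \<open>Each expectation depends only on the marginal law of its own chain, so both can be
  computed on the coupled space. There the Lipschitz bound applies pointwise and the coupling
  controls the mean Hamming distance.\<close>

lemma contractive_expectation_diff:
  fixes f :: "('n::finite) config \<Rightarrow> real"
  assumes "contractive \<alpha> P" and lip: "hamming_lipschitz L f" and "0 \<le> L"
  shows "\<bar>measure_pmf.expectation (kernel_power P t x) f -
    measure_pmf.expectation (kernel_power P t y) f\<bar> \<le> L * \<alpha> ^ t * hamming x y"
proof -
  obtain M :: "(nat \<Rightarrow> 'n config \<times> 'n config) measure" and X Y where
    X: "markov_chain_from P x M X" and Y: "markov_chain_from P y M Y" and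
    contr: "(\<integral>w. hamming (X t w) (Y t w) \<partial>M) \<le> \<alpha> ^ t * hamming x y"
    using assms(1) unfolding contractive_def by blast
  interpret prob_space M
    using X by (simp add: markov_chain_from_def)
  have [measurable]: "X t \<in> measurable M (count_space UNIV)" "Y t \<in> measurable M (count_space UNIV)"
    using X Y by (simp_all add: markov_chain_from_def)
  \<comment> \<open>A function of the pair of states takes finitely many values, so the maximum of
    its absolute value is an integrable bound.\<close>
  have integrable: "integrable M (\<lambda>w. g (X t w) (Y t w))" for g :: "'n config \<Rightarrow> 'n config \<Rightarrow> real"
  proof (rule integrable_const_bound)
    show "AE w in M. norm (g (X t w) (Y t w)) \<le> (MAX u. \<bar>g (fst u) (snd u)\<bar>)"
      by (intro AE_I2 Max_ge) (auto intro!: image_eqI[where x = "(X t _, Y t _)"])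
    show "(\<lambda>w. g (X t w) (Y t w)) \<in> borel_measurable M"
      by measurable
  qed
  have "measure_pmf.expectation (kernel_power P t x) f - measure_pmf.expectation (kernel_power P t y) f
      = (\<integral>w. f (X t w) - f (Y t w) \<partial>M)"
    using integrable[of "\<lambda>a b. f a"] integrable[of "\<lambda>a b. f b"]
    by (simp add: markov_chain_from_integral[OF X] markov_chain_from_integral[OF Y])
  also have "\<bar>\<dots>\<bar> \<le> (\<integral>w. \<bar>f (X t w) - f (Y t w)\<bar> \<partial>M)"
    by (rule integral_abs_bound)
  also have "\<dots> \<le> (\<integral>w. L * hamming (X t w) (Y t w) \<partial>M)"
    using lip by (intro integral_mono integrable[of "\<lambda>a b. \<bar>f a - f b\<bar>"]
      integrable[of "\<lambda>a b. L * hamming a b"]) (simp add: hamming_lipschitz_def)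
  also have "\<dots> \<le> L * (\<alpha> ^ t * hamming x y)"
    using contr \<open>0 \<le> L\<close> by (simp add: mult_left_mono)
  finally show ?thesis
    by (simp add: mult.assoc)
qed

lemma bind_kernel_power:
  assumes "bind_pmf p P = p"
  shows "bind_pmf p (kernel_power P t) = p"
proof (induction t)
  case 0
  show ?case
    by (simp add: bind_return_pmf')
next
  case (Suc t)
  have "kernel_power P (Suc t) = (\<lambda>x. bind_pmf (P x) (kernel_power P t))"
    by (simp add: fun_eq_iff)
  then have "bind_pmf p (kernel_power P (Suc t)) = bind_pmf (bind_pmf p P) (kernel_power P t)"
    by (simp only: bind_assoc_pmf)
  also have "\<dots> = p"
    unfolding assms by (rule Suc)
  finally show ?case .
qed

lemma hamming_le_card: "hamming x (y :: ('n::finite) config) \<le> real CARD('n)"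
  unfolding hamming_def by (rule order_trans[OF sum_bounded_above[where K = 1]]) auto

lemma hamming_upd: "hamming (x(i := a)) (x(i := b)) \<le> 1"
proof -
  have "hamming (x(i := a)) (x(i := b)) \<le> (\<Sum>j\<in>UNIV. if j = i then 1 else 0)"
    unfolding hamming_def by (intro sum_mono) auto
  then show ?thesis
    by simp
qed

text \<open>The index type is nonempty, so the all-\<open>Plus\<close> and all-\<open>Minus\<close>
  configurations are at positive distance, which excludes a negative \<open>L\<close>.\<close>

lemma hamming_lipschitz_nonneg:
  assumes "hamming_lipschitz L (f :: ('n::finite) config \<Rightarrow> real)"
  shows "0 \<le> L"
proof -
  have "0 \<le> L * hamming (\<lambda>_::'n. Plus) (\<lambda>_. Minus)"
    using assms unfolding hamming_lipschitz_def by (meson abs_ge_zero order_trans)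
  then show ?thesis
    by (simp add: hamming_def zero_le_mult_iff)
qed

text \<open>The solution is the Neumann series of the identity minus \<open>P\<close>, applied to
  the centred \<open>f\<close>. Contraction gives geometric decay of its terms, hence
  convergence.\<close>

lemma contractive_poisson_solution:
  fixes f :: "('n::finite) config \<Rightarrow> real"
  assumes \<alpha>: "0 \<le> \<alpha>" "\<alpha> < 1" and contr: "contractive \<alpha> P"
    and lip: "hamming_lipschitz L f" and stationary: "bind_pmf p P = p"
  obtains h where "\<And>x. h x - kernel_app P h x = f x - measure_pmf.expectation p f"
    and "\<And>i x. \<bar>discrete_deriv i h x\<bar> \<le> L / (1 - \<alpha>)"
proof -
  let ?c = "measure_pmf.expectation p f"
  let ?E = "\<lambda>t x. measure_pmf.expectation (kernel_power P t x) f"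
  have L: "0 \<le> L"
    using lip by (rule hamming_lipschitz_nonneg)
  note diff = contractive_expectation_diff[OF contr lip L]
  have geometric: "summable (\<lambda>t. K * \<alpha> ^ t)" for K :: real
    using \<alpha> by (intro summable_mult summable_geometric) simp
  have decay: "\<bar>?E t x - ?c\<bar> \<le> L * real CARD('n) * \<alpha> ^ t" for t x
  proof -
    \<comment> \<open>Stationarity writes the centring constant as an average of
      \<open>?E t y\<close> over starting points \<open>y\<close>, each at Hamming distance at most
      \<open>CARD('n)\<close> from \<open>x\<close>.\<close>
    have "?c = measure_pmf.expectation p (?E t)"
      by (subst (1) bind_kernel_power[OF stationary, of t, symmetric])
        (rule expectation_bind_finite_type)
    then have "?E t x - ?c = measure_pmf.expectation p (\<lambda>y. ?E t x - ?E t y)"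
      by (simp add: integrable_pmf_finite_type)
    also have "\<bar>\<dots>\<bar> \<le> measure_pmf.expectation p (\<lambda>y. \<bar>?E t x - ?E t y\<bar>)"
      by (rule integral_abs_bound)
    also have "\<dots> \<le> measure_pmf.expectation p (\<lambda>y. L * \<alpha> ^ t * real CARD('n))"
      using L \<alpha>
      by (intro integral_mono integrable_pmf_finite_type order_trans[OF diff] mult_left_mono
          hamming_le_card) auto
    finally show ?thesis
      by (simp add: mult_ac)
  qed
  have summable: "summable (\<lambda>t. ?E t x - ?c)" for x
    by (rule summable_comparison_test'[OF geometric]) (use decay in simp)
  define h where "h x = (\<Sum>t. ?E t x - ?c)" for x
  show thesis
  proof
    fix x
    \<comment> \<open>Applying \<open>P\<close> shifts the series by one index, so subtracting it
      from \<open>h x\<close> leaves the term at time 0, which is \<open>f x - ?c\<close>.\<close>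
    have "kernel_app P h x = (\<Sum>t. \<Sum>y\<in>UNIV. pmf (P x) y * (?E t y - ?c))"
      unfolding kernel_app_def h_def
      by (subst suminf_sum) (auto intro!: summable_mult summable sum.cong simp: suminf_mult summable)
    also have "\<dots> = (\<Sum>t. ?E (Suc t) x - ?c)"
    proof (rule suminf_cong)
      fix t
      have "(\<Sum>y\<in>UNIV. pmf (P x) y * (?E t y - ?c)) = measure_pmf.expectation (P x) (\<lambda>y. ?E t y - ?c)"
        by (simp add: expectation_pmf_finite_type)
      then show "(\<Sum>y\<in>UNIV. pmf (P x) y * (?E t y - ?c)) = ?E (Suc t) x - ?c"
        by (simp add: expectation_bind_finite_type integrable_pmf_finite_type)
    qed
    also have "\<dots> = h x - (f x - ?c)"
      unfolding h_def using suminf_split_head[OF summable[of x]] by simp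
    finally show "h x - kernel_app P h x = f x - ?c"
      by simp
  next
    fix i x
    let ?d = "\<lambda>t. ?E t (x(i := Plus)) - ?E t (x(i := Minus))"
    \<comment> \<open>The two starting points differ at most at \<open>i\<close>, so their distance
      is at most 1 and no factor \<open>CARD('n)\<close> appears.\<close>
    have d: "\<bar>?d t\<bar> \<le> L * \<alpha> ^ t" for t
      using mult_left_mono[OF hamming_upd[of x i Plus Minus], of "L * \<alpha> ^ t"] L \<alpha>
      by (intro order_trans[OF diff]) simp
    have "discrete_deriv i h x = (\<Sum>t. ?d t)"
      unfolding discrete_deriv_def h_def by (subst suminf_diff) (auto intro: summable)
    also have "\<bar>\<dots>\<bar> \<le> (\<Sum>t. \<bar>?d t\<bar>)"
      using d by (intro summable_rabs summable_comparison_test'[OF geometric[of L]]) simp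
    also have "\<dots> \<le> (\<Sum>t. L * \<alpha> ^ t)"
      using d by (intro suminf_le geometric summable_comparison_test'[OF geometric[of L]]) auto
    also have "\<dots> = L / (1 - \<alpha>)"
      using \<alpha> by (simp add: suminf_mult suminf_geometric)
    finally show "\<bar>discrete_deriv i h x\<bar> \<le> L / (1 - \<alpha>)" .
  qed
qed

text \<open>The Poisson equation is solved here by the series, so no solution is assumed. Keeping
  \<open>f\<close> arbitrary allows the bound to be reused for \<open>g (f x)\<close>.\<close>

lemma contractive_bound:
  fixes \<mu> \<nu> :: "('n::finite) config pmf"
  assumes "0 \<le> \<alpha>" "\<alpha> < 1" "contractive \<alpha> (glauber \<mu>)" "hamming_lipschitz L f"
  shows "\<bar>measure_pmf.expectation \<mu> f - measure_pmf.expectation \<nu> f\<bar>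
    \<le> L / (1 - \<alpha>) * measure_pmf.expectation \<nu> (\<lambda>x. 1 / real CARD('n) *
        (\<Sum>i\<in>UNIV. tv_dist (cond_coord \<mu> i x) (cond_coord \<nu> i x)))"
proof -
  obtain h where poisson: "\<And>x. h x - kernel_app (glauber \<mu>) h x = f x - measure_pmf.expectation \<mu> f"
    and deriv: "\<And>i x. \<bar>discrete_deriv i h x\<bar> \<le> L / (1 - \<alpha>)"
    using contractive_poisson_solution[OF assms bind_glauber] by blast
  have "\<bar>measure_pmf.expectation \<mu> f - measure_pmf.expectation \<nu> f\<bar>
    \<le> measure_pmf.expectation \<nu> (\<lambda>x. 1 / real CARD('n) *
        (\<Sum>i\<in>UNIV. \<bar>discrete_deriv i h x\<bar> * tv_dist (cond_coord \<mu> i x) (cond_coord \<nu> i x)))"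
    using poisson by (rule poisson_bound)
  also have "\<dots> \<le> measure_pmf.expectation \<nu> (\<lambda>x. 1 / real CARD('n) *
        (\<Sum>i\<in>UNIV. L / (1 - \<alpha>) * tv_dist (cond_coord \<mu> i x) (cond_coord \<nu> i x)))"
    by (intro integral_mono integrable_pmf_finite_type mult_left_mono sum_mono mult_right_mono
        deriv tv_dist_nonneg) simp
  also have "\<dots> = L / (1 - \<alpha>) * measure_pmf.expectation \<nu> (\<lambda>x. 1 / real CARD('n) *
        (\<Sum>i\<in>UNIV. tv_dist (cond_coord \<mu> i x) (cond_coord \<nu> i x)))"
    unfolding sum_distrib_left[symmetric] mult.left_commute[of "1 / real CARD('n)"]
    by (rule integral_mult_right_zero)
  finally show ?thesis .
qed

section \<open>Wasserstein distance and conclusion\<close>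

lemma has_law_integral:
  fixes g :: "'a \<Rightarrow> real"
  assumes "has_law M Z p"
  shows "(\<integral>w. g (Z w) \<partial>M) = measure_pmf.expectation p g"
proof -
  have "measure_pmf.expectation p g = integral\<^sup>L (distr M (count_space UNIV) Z) g"
    using assms by (simp add: has_law_def)
  also have "\<dots> = (\<integral>w. g (Z w) \<partial>M)"
    using assms by (intro integral_distr) (auto simp: has_law_def)
  finally show ?thesis
    by simp
qed

lemma hamming_lipschitz_compose:
  assumes "1-lipschitz_on UNIV (g :: real \<Rightarrow> real)" and "hamming_lipschitz L f"
  shows "hamming_lipschitz L (\<lambda>x. g (f x))"
  unfolding hamming_lipschitz_def
proof (intro allI)
  fix x y
  have "\<bar>g (f x) - g (f y)\<bar> \<le> \<bar>f x - f y\<bar>"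
    using lipschitz_onD[OF assms(1), of "f x" "f y"] by (simp add: dist_real_def)
  also have "\<dots> \<le> L * hamming x y"
    using assms(2) by (simp add: hamming_lipschitz_def)
  finally show "\<bar>g (f x) - g (f y)\<bar> \<le> L * hamming x y" .
qed

theorem theorem3p1:
  fixes \<mu> \<nu> :: "('n::finite) config pmf"
    and f h :: "'n config \<Rightarrow> real"
    and \<alpha> L :: real
    and M :: "'v measure" and Z\<^sub>\<mu> :: "'v \<Rightarrow> 'n config"
    and N :: "'w measure" and Z\<^sub>\<nu> :: "'w \<Rightarrow> 'n config"
  assumes "irreducible_kernel (glauber \<mu>)"
  shows
    "((\<forall>x. h x - kernel_app (glauber \<mu>) h x = f x - measure_pmf.expectation \<mu> f) \<longrightarrow>
        \<bar>measure_pmf.expectation \<mu> f - measure_pmf.expectation \<nu> f\<bar>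
          \<le> measure_pmf.expectation \<nu> (\<lambda>x. 1 / real CARD('n) *
              (\<Sum>i\<in>UNIV. \<bar>discrete_deriv i h x\<bar> * tv_dist (cond_coord \<mu> i x) (cond_coord \<nu> i x)))) \<and>
     (0 \<le> \<alpha> \<and> \<alpha> < 1 \<and> contractive \<alpha> (glauber \<mu>) \<and> hamming_lipschitz L f \<longrightarrow>
        \<bar>measure_pmf.expectation \<mu> f - measure_pmf.expectation \<nu> f\<bar>
          \<le> L / (1 - \<alpha>) * measure_pmf.expectation \<nu> (\<lambda>x. 1 / real CARD('n) *
              (\<Sum>i\<in>UNIV. tv_dist (cond_coord \<mu> i x) (cond_coord \<nu> i x))) \<and>
        (has_law M Z\<^sub>\<mu> \<mu> \<and> has_law N Z\<^sub>\<nu> \<nu> \<longrightarrow>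
          wasserstein M (\<lambda>w. f (Z\<^sub>\<mu> w)) N (\<lambda>w. f (Z\<^sub>\<nu> w))
            \<le> ereal (L / (1 - \<alpha>) * measure_pmf.expectation \<nu> (\<lambda>x. 1 / real CARD('n) *
                (\<Sum>i\<in>UNIV. tv_dist (cond_coord \<mu> i x) (cond_coord \<nu> i x))))))"
proof (intro conjI impI)
  assume "\<forall>x. h x - kernel_app (glauber \<mu>) h x = f x - measure_pmf.expectation \<mu> f"
  then show "\<bar>measure_pmf.expectation \<mu> f - measure_pmf.expectation \<nu> f\<bar>
      \<le> measure_pmf.expectation \<nu> (\<lambda>x. 1 / real CARD('n) *
          (\<Sum>i\<in>UNIV. \<bar>discrete_deriv i h x\<bar> * tv_dist (cond_coord \<mu> i x) (cond_coord \<nu> i x)))"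
    by (intro poisson_bound) simp
next
  let ?B = "L / (1 - \<alpha>) * measure_pmf.expectation \<nu> (\<lambda>x. 1 / real CARD('n) *
      (\<Sum>i\<in>UNIV. tv_dist (cond_coord \<mu> i x) (cond_coord \<nu> i x)))"
  assume asm: "0 \<le> \<alpha> \<and> \<alpha> < 1 \<and> contractive \<alpha> (glauber \<mu>) \<and> hamming_lipschitz L f"
  then show "\<bar>measure_pmf.expectation \<mu> f - measure_pmf.expectation \<nu> f\<bar> \<le> ?B"
    by (intro contractive_bound) auto
  assume law: "has_law M Z\<^sub>\<mu> \<mu> \<and> has_law N Z\<^sub>\<nu> \<nu>"
  show "wasserstein M (\<lambda>w. f (Z\<^sub>\<mu> w)) N (\<lambda>w. f (Z\<^sub>\<nu> w)) \<le> ereal ?B"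
    unfolding wasserstein_def
  proof (rule SUP_least)
    fix g :: "real \<Rightarrow> real" assume "g \<in> {g. 1-lipschitz_on UNIV g}"
    then have "hamming_lipschitz L (\<lambda>x. g (f x))"
      using asm by (auto intro!: hamming_lipschitz_compose[of g L f])
    \<comment> \<open>The right-hand side involves the test function only through \<open>L\<close>,
      so the same \<open>?B\<close> serves every \<open>g\<close> in the supremum.\<close>
    then have "\<bar>measure_pmf.expectation \<mu> (\<lambda>x. g (f x)) - measure_pmf.expectation \<nu> (\<lambda>x. g (f x))\<bar> \<le> ?B"
      using asm by (intro contractive_bound) auto
    moreover have "(\<integral>w. g (f (Z\<^sub>\<mu> w)) \<partial>M) = measure_pmf.expectation \<mu> (\<lambda>x. g (f x))"
      and "(\<integral>w. g (f (Z\<^sub>\<nu> w)) \<partial>N) = measure_pmf.expectation \<nu> (\<lambda>x. g (f x))"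
      using law by (auto intro: has_law_integral)
    ultimately show "ereal ((\<integral>w. g (f (Z\<^sub>\<mu> w)) \<partial>M) - (\<integral>w. g (f (Z\<^sub>\<nu> w)) \<partial>N)) \<le> ereal ?B"
      by simp
  qed
qed

end
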